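(* For every integer $n\ge0$ the following four expressions are equal: \begin{align*} &\frac{4}{n+1}\sum_{0\le k<\ell<\lceil n/2\rceil}\frac{\binom nk}{\binom n\ell}+[n\text{ even}]\frac1{n+1}\Bigl(\frac{2^n}{\binom n{n/2}}-1\Bigr)+1\\ &=\frac{2}{\lfloor n/2\rfloor+1}\sum_{0\le k<\ell\le\lfloor n/2\rfloor}\frac{\binom{2\lfloor n/2\rfloor+1}{k}}{\binom{2\lfloor n/2\rfloor+1}{\ell}}+1\\ &=\frac1{n+1}\sum_{m=0}^{\lfloor n/2\rfloor}\sum_{\ell=m}^{n-m}\frac{\binom{2m}{m}\binom{n-2m}{\ell-m}}{\binom n\ell}\\ &=H^{\mathrm{odd}}_{n+1}. \end{align*}
   Context: $H^{\mathrm{odd}}_m=\sum_{j=1}^m\frac{[j\text{ odd}]}{j}$; $[P]=1$ if $P$ is true and $0$ otherwise. *)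

theory Defs
  imports Complex_Main
begin

definition H_odd :: "nat \<Rightarrow> real" where
  "H_odd m = (\<Sum>j=1..m. of_bool (odd j) / real j)"

end

theory Submission
  imports Defs
begin

text \<open>
  Write \<open>R n l\<close> for the sum of the entries to the left of \<open>n choose l\<close> in its row of Pascal's triangle,
  divided by \<open>n choose l\<close>. Pascal's rule together with
  \<open>1 / (n choose l) = (n + 1) / (n + 2) * (1 / (n + 1 choose l) + 1 / (n + 1 choose (l + 1)))\<close> expresses \<open>R n l\<close>
  through \<open>R (n + 1) l + R (n + 1) (l + 1)\<close>. Summed over the left half of a row, this links consecutive
  rows: from row \<open>2 * h\<close> to row \<open>2 * h + 1\<close> it identifies the first two expressions, and
  from row \<open>2 * h + 1\<close> to row \<open>2 * h + 2\<close> it then shows that the second one grows by \<open>1 / (2 * h + 3)\<close>.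
  For the third expression, \<open>1 / ((n + 1) * (n choose l))\<close> is the integral of \<open>x ^ l * (1 - x) ^ (n - l)\<close>
  over the unit interval, so the inner sum collapses by the binomial theorem to \<open>1 / (2 * m + 1)\<close>.
\<close>

section \<open>Left partial row sums of Pascal's triangle\<close>

definition left_ratio :: "nat \<Rightarrow> nat \<Rightarrow> real" where
  "left_ratio n l = (\<Sum>k<l. real (n choose k)) / real (n choose l)"

lemma left_ratio_0 [simp]: "left_ratio n 0 = 0"
  by (simp add: left_ratio_def)

text \<open>By Pascal's rule each entry of row \<open>n\<close> left of \<open>l\<close> feeds two
  summands, while \<open>n choose l\<close> feeds only one.\<close>

lemma sum_choose_Suc_row:
  "(\<Sum>k<Suc l. real (Suc n choose k)) = 2 * (\<Sum>k<l. real (n choose k)) + real (n choose l)"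
  by (induction l) auto

lemma choose_div_Suc_choose_Suc:
  assumes "l \<le> n"
  shows "real (n choose l) / real (Suc n choose Suc l) = (real l + 1) / (real n + 1)"
proof -
  have "real (Suc l) * real (Suc n choose Suc l) = real (Suc n) * real (n choose l)"
    by (metis Suc_times_binomial of_nat_mult)
  moreover have "real (Suc n choose Suc l) > 0"
    using assms by (simp del: binomial_Suc_Suc)
  ultimately show ?thesis
    by (simp add: field_simps del: binomial_Suc_Suc)
qed

lemma choose_div_Suc_choose:
  assumes "l \<le> n"
  shows "real (n choose l) / real (Suc n choose l) = (real n + 1 - real l) / (real n + 1)"
proof -
  have "(Suc n - l) * (Suc n choose l) = Suc n * (n choose l)"
    using binomial_absorb_comp[of "Suc n" l] by simp
  hence "real (Suc n - l) * real (Suc n choose l) = real (Suc n) * real (n choose l)"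
    by (metis of_nat_mult)
  moreover have "real (Suc n - l) = real n + 1 - real l"
    using assms by (simp add: of_nat_diff)
  moreover have "real (Suc n choose l) > 0"
    using assms by simp
  ultimately show ?thesis
    by (simp add: field_simps)
qed

text \<open>Both ratios on the left are affine in \<open>left_ratio n l\<close>. Their weights
  \<open>(l + 1) / (n + 1)\<close> and \<open>(n + 1 - l) / (n + 1)\<close> depend on
  \<open>l\<close>, but their sum does not; likewise the constants leave
  \<open>1 / (n + 1)\<close>.\<close>

lemma left_ratio_Suc_row:
  assumes "l \<le> n"
  shows "left_ratio (Suc n) l + left_ratio (Suc n) (Suc l)
    = 2 * (real n + 2) / (real n + 1) * left_ratio n l + 1 / (real n + 1)"
proof -
  define Q where "Q = (\<Sum>k<l. real (n choose k))"
  define c where "c = real (n choose l)"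
  have c: "c > 0" using assms by (simp add: c_def)
  have "left_ratio (Suc n) (Suc l) = (2 * Q + c) / real (Suc n choose Suc l)"
    unfolding left_ratio_def sum_choose_Suc_row by (simp add: Q_def c_def)
  also have "\<dots> = (2 * Q / c + 1) * (c / real (Suc n choose Suc l))"
  proof -
    have "(2 * Q / c + 1) * c = 2 * Q + c"
      using c by (simp add: distrib_right)
    thus ?thesis
      unfolding times_divide_eq_right by (rule arg_cong[OF sym])
  qed
  also have "\<dots> = (2 * left_ratio n l + 1) * ((real l + 1) / (real n + 1))"
    unfolding c_def choose_div_Suc_choose_Suc[OF assms] by (simp add: left_ratio_def Q_def)
  finally have right: "left_ratio (Suc n) (Suc l) = (2 * left_ratio n l + 1) * ((real l + 1) / (real n + 1))" .
  have left: "left_ratio (Suc n) l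
    = 2 * left_ratio n l * ((real n + 1 - real l) / (real n + 1)) - real l / (real n + 1)"
  proof (cases l)
    case (Suc i)
    \<comment> \<open>\<open>Q\<close> already contains the entry \<open>n choose i\<close>, which
      must be counted only once.\<close>
    have "(\<Sum>k<l. real (Suc n choose k)) = 2 * Q - real (n choose i)"
      unfolding Suc sum_choose_Suc_row by (simp add: Q_def Suc)
    hence "left_ratio (Suc n) l
      = 2 * (Q / c) * (c / real (Suc n choose l)) - real (n choose i) / real (Suc n choose l)"
      using c by (simp add: left_ratio_def diff_divide_distrib)
    also have "real (n choose i) / real (Suc n choose l) = real l / (real n + 1)"
      using choose_div_Suc_choose_Suc[of i n] assms by (simp add: Suc del: binomial_Suc_Suc)
    also have "c / real (Suc n choose l) = (real n + 1 - real l) / (real n + 1)"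
      unfolding c_def by (rule choose_div_Suc_choose[OF assms])
    finally show ?thesis by (simp add: left_ratio_def Q_def c_def)
  qed simp
  show ?thesis
    unfolding left right by (simp add: divide_simps) (simp add: algebra_simps)
qed

text \<open>On summation over \<open>l < L\<close> every inner ratio of row \<open>Suc n\<close>
  occurs twice, the one at \<open>0\<close> vanishes, and the one at \<open>L\<close> remains as a
  boundary term.\<close>

lemma sum_left_ratio_Suc_row:
  assumes "L \<le> Suc n"
  shows "2 * (\<Sum>l<L. left_ratio (Suc n) l) + left_ratio (Suc n) L
    = 2 * (real n + 2) / (real n + 1) * (\<Sum>l<L. left_ratio n l) + real L / (real n + 1)"
  using assms
proof (induction L)
  case (Suc L)
  thus ?case
    using left_ratio_Suc_row[of L n] by (simp add: add_divide_distrib distrib_left)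
qed simp

section \<open>Boundary terms at the middle of a row\<close>

lemma sum_choose_half_odd_row: "(\<Sum>k<Suc h. real (2 * h + 1 choose k)) = 4 ^ h"
proof -
  have "(\<Sum>k<Suc h. real (2 * h + 1 choose k)) = real (\<Sum>k\<le>h. 2 * h + 1 choose k)"
    unfolding lessThan_Suc_atMost of_nat_sum ..
  also have "\<dots> = 4 ^ h"
    unfolding binomial_r_part_sum by (simp add: power_mult)
  finally show ?thesis .
qed

lemma left_ratio_odd_row:
  "left_ratio (2 * h + 1) h = (real h + 1) / (2 * real h + 1) * (4 ^ h / real (2 * h choose h)) - 1"
proof -
  have "(\<Sum>k<Suc h. real (2 * h + 1 choose k)) = 4 ^ h"
    by (rule sum_choose_half_odd_row)
  hence "(\<Sum>k<h. real (2 * h + 1 choose k)) = 4 ^ h - real (2 * h + 1 choose h)"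
    by simp
  hence "left_ratio (2 * h + 1) h = 4 ^ h / real (2 * h + 1 choose h) - 1"
    by (simp add: left_ratio_def diff_divide_distrib del: binomial_Suc_Suc)
  moreover have "real (2 * h choose h) / real (2 * h + 1 choose h) = (real h + 1) / (2 * real h + 1)"
    using choose_div_Suc_choose[of h "2 * h"] by simp
  hence "(real h + 1) / (2 * real h + 1) * (4 ^ h / real (2 * h choose h)) = 4 ^ h / real (2 * h + 1 choose h)"
    by (simp flip: \<open>_ = (real h + 1) / (2 * real h + 1)\<close>)
  ultimately show ?thesis by simp
qed

lemma left_ratio_even_row:
  "left_ratio (2 * h) h = (4 ^ h / real (2 * h choose h) - 1) / 2"
proof -
  have "(\<Sum>k<Suc h. real (Suc (2 * h) choose k)) = 4 ^ h"
    using sum_choose_half_odd_row[of h] by (simp only: Suc_eq_plus1)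
  hence "(\<Sum>k<h. real (2 * h choose k)) = (4 ^ h - real (2 * h choose h)) / 2"
    unfolding sum_choose_Suc_row by simp
  thus ?thesis
    by (simp add: left_ratio_def field_simps)
qed

section \<open>The first two expressions\<close>

text \<open>This is the equality of the first two expressions for \<open>n = 2 * h\<close>, without
  the summand 1. The step from row \<open>2 * h\<close> to row \<open>2 * h + 1\<close> is taken
  with \<open>L = h\<close>; its boundary term is also the last summand on the right.\<close>

lemma sum_left_ratio_even_row:
  "4 / (2 * real h + 1) * (\<Sum>l<h. left_ratio (2 * h) l)
     + (4 ^ h / real (2 * h choose h) - 1) / (2 * real h + 1)
   = 2 / (real h + 1) * (\<Sum>l<Suc h. left_ratio (2 * h + 1) l)"
proof -
  define x where "x = 4 ^ h / real (2 * h choose h)"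
  define S where "S = (\<Sum>l<h. left_ratio (2 * h) l)"
  define T where "T = (\<Sum>l<h. left_ratio (2 * h + 1) l)"
  have T: "T = (2 * (2 * real h + 2) / (2 * real h + 1) * S + real h / (2 * real h + 1)
      - ((real h + 1) / (2 * real h + 1) * x - 1)) / 2"
    using sum_left_ratio_Suc_row[of h "2 * h"] left_ratio_odd_row[of h]
    by (simp add: S_def T_def x_def)
  have ne: "2 * real h + 1 \<noteq> 0" "real h + 1 \<noteq> 0"
    by linarith+
  have "2 / (real h + 1) * (T + ((real h + 1) / (2 * real h + 1) * x - 1))
      = 4 / (2 * real h + 1) * S + (x - 1) / (2 * real h + 1)"
    unfolding T using ne by (simp add: divide_simps) (simp add: algebra_simps)
  thus ?thesis
    using left_ratio_odd_row[of h] by (simp add: S_def T_def x_def)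
qed

lemma H_odd_step: "H_odd (2 * Suc h + 1) = H_odd (2 * h + 1) + 1 / (2 * real h + 3)"
  by (simp add: H_odd_def)

lemma sum_left_ratio_odd_row:
  "2 / (real h + 1) * (\<Sum>l<Suc h. left_ratio (2 * h + 1) l) + 1 = H_odd (2 * h + 1)"
proof (induction h)
  case 0
  thus ?case by (simp add: H_odd_def)
next
  case (Suc h)
  define x where "x = 4 ^ Suc h / real (2 * Suc h choose Suc h)"
  define S where "S = (\<Sum>l<Suc h. left_ratio (2 * Suc h) l)"
  define T where "T = (\<Sum>l<Suc h. left_ratio (2 * h + 1) l)"
  have R: "left_ratio (Suc (2 * h + 1)) (Suc h) = (x - 1) / 2"
    using left_ratio_even_row[of "Suc h"] by (simp add: x_def del: binomial_Suc_Suc power_Suc)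
  have "2 * S + (x - 1) / 2
    = 2 * (2 * real h + 3) / (2 * real h + 2) * T + (real h + 1) / (2 * real h + 2)"
    using sum_left_ratio_Suc_row[of "Suc h" "2 * h + 1"]
    unfolding R S_def T_def by (simp add: add_ac del: sum.lessThan_Suc binomial_Suc_Suc power_Suc)
  hence S: "S = (2 * (2 * real h + 3) / (2 * real h + 2) * T + (real h + 1) / (2 * real h + 2)
      - (x - 1) / 2) / 2"
    by simp
  have ne: "2 * real h + 3 \<noteq> 0" "2 * real h + 2 \<noteq> 0" "real h + 1 \<noteq> 0"
    by linarith+
  have "2 / (real (Suc h) + 1) * (\<Sum>l<Suc (Suc h). left_ratio (2 * Suc h + 1) l)
      = 4 / (2 * real h + 3) * S + (x - 1) / (2 * real h + 3)"
    using sum_left_ratio_even_row[of "Suc h"]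
    unfolding S_def x_def by (simp add: add_ac del: sum.lessThan_Suc binomial_Suc_Suc power_Suc)
  \<comment> \<open>The central ratio \<open>x\<close> enters through the boundary term in
    \<open>S\<close> and through the explicit summand, with opposite signs, and cancels.\<close>
  also have "\<dots> = 2 / (real h + 1) * T + 1 / (2 * real h + 3)"
    unfolding S using ne by (simp add: divide_simps) (simp add: algebra_simps)
  finally show ?case
    using Suc.IH H_odd_step[of h] unfolding T_def by linarith
qed

section \<open>Beta integrals and the third expression\<close>

text \<open>The value of the beta integral of \<open>x ^ i * (1 - x) ^ k\<close> over the unit interval.\<close>
definition beta_nat :: "nat \<Rightarrow> nat \<Rightarrow> real" where
  "beta_nat i k = fact i * fact k / fact (i + k + 1)"

text \<open>Under the integral this is \<open>x + (1 - x) = 1\<close>.\<close>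

lemma beta_nat_Suc_add: "beta_nat (Suc i) k + beta_nat i (Suc k) = beta_nat i k"
proof -
  have "(2 + real i + real k) \<noteq> 0" "1 + real i + real k \<noteq> 0" by linarith+
  thus ?thesis
    by (simp add: beta_nat_def divide_simps add_ac) (simp add: algebra_simps)
qed

lemma beta_nat_eq_choose:
  assumes "l \<le> n"
  shows "beta_nat l (n - l) = 1 / ((real n + 1) * real (n choose l))"
  using assms by (simp add: beta_nat_def binomial_fact field_simps)

text \<open>Under the integral this is the binomial expansion of
  \<open>(x + (1 - x)) ^ p = 1\<close>.\<close>

lemma sum_choose_beta_nat:
  "(\<Sum>j\<le>p. real (p choose j) * beta_nat (a + j) (b + (p - j))) = beta_nat a b"
proof (induction p arbitrary: a b)
  case (Suc p)
  have "(\<Sum>j\<le>Suc p. real (Suc p choose j) * beta_nat (a + j) (b + (Suc p - j)))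
      = beta_nat a (b + Suc p)
        + (\<Sum>j\<le>p. real (p choose Suc j) * beta_nat (a + Suc j) (b + (p - j)))
        + (\<Sum>j\<le>p. real (p choose j) * beta_nat (a + Suc j) (b + (p - j)))"
    by (simp add: sum.atMost_Suc_shift distrib_right sum.distrib del: sum.atMost_Suc)
  also have "beta_nat a (b + Suc p)
        + (\<Sum>j\<le>p. real (p choose Suc j) * beta_nat (a + Suc j) (b + (p - j)))
      = (\<Sum>j\<le>Suc p. real (p choose j) * beta_nat (a + j) (b + (Suc p - j)))"
    by (simp add: sum.atMost_Suc_shift del: sum.atMost_Suc)
  \<comment> \<open>The summand at \<open>j = Suc p\<close> drops out because
    \<open>p choose Suc p\<close> is 0.\<close>
  also have "\<dots> = (\<Sum>j\<le>p. real (p choose j) * beta_nat (a + j) (Suc b + (p - j)))"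
    by (simp add: Suc_diff_le)
  also have "\<dots> = beta_nat a (Suc b)"
    by (rule Suc.IH)
  also have "(\<Sum>j\<le>p. real (p choose j) * beta_nat (a + Suc j) (b + (p - j))) = beta_nat (Suc a) b"
    using Suc.IH[of "Suc a" b] by simp
  finally show ?case
    using beta_nat_Suc_add[of a b] by simp
qed simp

lemma sum_choose_div_choose:
  assumes "2 * m \<le> n"
  shows "(\<Sum>l=m..n - m. real ((2 * m) choose m) * real ((n - 2 * m) choose (l - m)) / real (n choose l))
    = (real n + 1) / (2 * real m + 1)"
proof -
  define p where "p = n - 2 * m"
  define c where "c = real ((2 * m) choose m)"
  have n: "n = p + 2 * m" using assms by (simp add: p_def)
  have c: "c > 0" by (simp add: c_def)
  have "(\<Sum>l=m..n - m. c * real (p choose (l - m)) / real (n choose l))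
      = (\<Sum>j\<le>p. c * real (p choose j) / real (n choose (m + j)))"
    by (rule sum.reindex_bij_witness[of _ "\<lambda>j. m + j" "\<lambda>l. l - m"]) (auto simp: n)
  also have "\<dots> = (\<Sum>j\<le>p. (real n + 1) * c * (real (p choose j) * beta_nat (m + j) (m + (p - j))))"
  proof (rule sum.cong)
    fix j assume "j \<in> {..p}"
    hence "m + j \<le> n" "n - (m + j) = m + (p - j)" by (auto simp: n)
    hence "beta_nat (m + j) (m + (p - j)) = 1 / ((real n + 1) * real (n choose (m + j)))"
      using beta_nat_eq_choose[of "m + j" n] by simp
    moreover have "real n + 1 \<noteq> 0" by linarith
    ultimately show "c * real (p choose j) / real (n choose (m + j))
      = (real n + 1) * c * (real (p choose j) * beta_nat (m + j) (m + (p - j)))"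
      by simp
  qed simp
  also have "\<dots> = (real n + 1) * c * beta_nat m m"
    unfolding sum_distrib_left[symmetric] sum_choose_beta_nat ..
  \<comment> \<open>The central binomial coefficient \<open>c\<close> cancels, since
    \<open>beta_nat m m\<close> is \<open>1 / ((2 * m + 1) * c)\<close>.\<close>
  also have "\<dots> = (real n + 1) / (2 * real m + 1)"
    using beta_nat_eq_choose[of m "2 * m"] c by (simp add: c_def[symmetric])
  finally show ?thesis
    by (simp add: c_def p_def)
qed

lemma sum_odd_reciprocals: "(\<Sum>m=0..h. 1 / (2 * real m + 1)) = H_odd (2 * h + 1)"
proof (induction h)
  case (Suc h)
  thus ?case unfolding H_odd_step by (simp add: add_ac)
qed (simp add: H_odd_def)

text \<open>For odd \<open>n\<close> the index \<open>n + 1\<close> is even and contributes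
  nothing.\<close>

lemma H_odd_half: "H_odd (2 * (n div 2) + 1) = H_odd (n + 1)"
proof (cases "even n")
  case False
  then obtain h where "n = 2 * h + 1" by (elim oddE)
  thus ?thesis by (simp add: H_odd_def)
qed simp

lemma sum_pairs_eq_left_ratio:
  "(\<Sum>(k, l) \<in> {(k, l). k < l \<and> l < L}. real (n choose k) / real (n choose l)) = (\<Sum>l<L. left_ratio n l)"
proof -
  have "(\<Sum>l<L. left_ratio n l) = (\<Sum>(l, k) \<in> Sigma {..<L} lessThan. real (n choose k) / real (n choose l))"
    by (simp add: left_ratio_def sum_divide_distrib sum.Sigma)
  also have "\<dots> = (\<Sum>(k, l) \<in> {(k, l). k < l \<and> l < L}. real (n choose k) / real (n choose l))"
    by (rule sum.reindex_bij_witness[of _ prod.swap prod.swap]) auto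
  finally show ?thesis ..
qed

theorem theorem7p1:
  fixes n :: nat
  defines "A \<equiv> 4 / (real n + 1) *
      (\<Sum>(k, l) \<in> {(k, l). k < l \<and> int l < \<lceil>real n / 2\<rceil>}.
        real (n choose k) / real (n choose l))
      + of_bool (even n) * (1 / (real n + 1)) * (2 ^ n / real (n choose (n div 2)) - 1) + 1"
  defines "B \<equiv> 2 / (real (n div 2) + 1) *
      (\<Sum>(k, l) \<in> {(k, l). k < l \<and> l \<le> n div 2}.
        real ((2 * (n div 2) + 1) choose k) / real ((2 * (n div 2) + 1) choose l)) + 1"
  defines "C \<equiv> 1 / (real n + 1) *
      (\<Sum>m = 0..n div 2. \<Sum>l = m..n - m.
        real ((2 * m) choose m) * real ((n - 2 * m) choose (l - m)) / real (n choose l))"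
  shows "A = B \<and> B = C \<and> C = H_odd (n + 1)"
proof -
  define h where "h = n div 2"
  have B: "B = 2 / (real h + 1) * (\<Sum>l<Suc h. left_ratio (2 * h + 1) l) + 1"
    unfolding B_def h_def[symmetric] sum_pairs_eq_left_ratio[symmetric] less_Suc_eq_le ..
  have "A = B"
  proof (cases "even n")
    case True
    hence n: "n = 2 * h" by (simp add: h_def)
    have ceil: "(int l < \<lceil>real n / 2\<rceil>) = (l < h)" for l by (simp add: n)
    show ?thesis
      using sum_left_ratio_even_row[of h] True
      unfolding A_def B ceil sum_pairs_eq_left_ratio h_def[symmetric] by (simp add: n power_mult)
  next
    case False
    hence n: "n = 2 * h + 1" by (simp add: h_def)
    \<comment> \<open>Here the ceiling is \<open>h + 1\<close> and \<open>n\<close> is itself the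
      row \<open>2 * h + 1\<close>, so both expressions have the same double sum.\<close>
    have ceil: "(int l < \<lceil>real n / 2\<rceil>) = (l < Suc h)" for l
      unfolding n less_ceiling_iff by auto
    have "4 / (real n + 1) = 2 / (real h + 1)"
      by (simp add: n field_simps)
    thus ?thesis
      using False unfolding A_def B ceil sum_pairs_eq_left_ratio by (simp add: n)
  qed
  moreover have "B = H_odd (n + 1)"
    using sum_left_ratio_odd_row[of h] H_odd_half[of n] by (simp add: B h_def)
  moreover have "C = H_odd (n + 1)"
  proof -
    have "C = 1 / (real n + 1) * (\<Sum>m = 0..h. (real n + 1) / (2 * real m + 1))"
      unfolding C_def h_def
      by (intro arg_cong[where f = "\<lambda>s. 1 / (real n + 1) * s"] sum.cong refl sum_choose_div_choose)
        auto
    also have "\<dots> = (\<Sum>m = 0..h. 1 / (2 * real m + 1))"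
      unfolding sum_distrib_left by (intro sum.cong) (auto simp: add_eq_0_iff)
    also have "\<dots> = H_odd (n + 1)"
      unfolding sum_odd_reciprocals h_def by (rule H_odd_half)
    finally show ?thesis .
  qed
  ultimately show ?thesis by simp
qed

end
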